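(* Let $\mathcal I$ be an ideal on $\mathbb N$. Let $g:(0,\infty)\to(0,\infty)$ be a strictly increasing function such that $\lim_{x\to 0^+} \frac{g(x)}{x^\gamma}=M$ for some positive constants $\gamma,M\in(0,\infty)$. Let $(b_n)_{n\in\mathbb N}$ and $(c_n)_{n\in\mathbb N}$ be sequences of positive reals such that $\lim_{n\to\infty} c_n=\infty$. Then the following conditions are equivalent. (1) For every sequence $(a_n)_{n\in\mathbb N}$ with $a_n\in\mathrm{ran}(g)$ for all $n$: if $\sum_{n=1}^{\infty} b_n a_n<\infty$ then $\mathcal I^*\text{-}\lim c_n g^{-1}(a_n)=0$. (2) For every sequence $(a_n)_{n\in\mathbb N}$ with $a_n\in\mathrm{ran}(g)$ for all $n$: if $\sum_{n=1}^{\infty} b_n a_n<\infty$ then $\mathcal I\text{-}\lim c_n g^{-1}(a_n)=0$. (3) $\mathcal I_{(b_n g(1/c_n))}\subseteq \mathcal I$.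
   Context: $\mathbb N=\{1,2,\dots\}$. An ideal on $\mathbb N$ is a nonempty family $\mathcal I\subseteq\mathcal P(\mathbb N)$ closed under subsets and finite unions, containing all finite subsets of $\mathbb N$, with $\mathbb N\notin\mathcal I$. $\mathcal I^*=\{\mathbb N\setminus A: A\in\mathcal I\}$ is the dual filter. For a real sequence $(x_n)$: $\mathcal I\text{-}\lim x_n=L$ means $\{n\in\mathbb N:|x_n-L|\ge\varepsilon\}\in\mathcal I$ for every $\varepsilon>0$; $\mathcal I^*\text{-}\lim x_n=L$ means there is $F\in\mathcal I^*$ such that the subsequence $(x_n)_{n\in F}$ converges to $L$ in the ordinary sense. For a sequence $(d_n)$ of nonnegative reals, $\mathcal I_{(d_n)}=\{A\subseteq\mathbb N:\sum_{n\in A}d_n<\infty\}$. $\mathrm{ran}(g)$ is the range of $g$, and $g^{-1}:\mathrm{ran}(g)\to(0,\infty)$ is the inverse of the injective function $g$. *)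

theory Defs
  imports "HOL-Analysis.Analysis"
begin

text \<open>
  The index set is the set \<open>{1..}\<close> of positive integers. Sequences are functions on \<open>nat\<close>
  whose value at \<open>0\<close> is never used.
\<close>

definition nat_ideal :: "nat set set \<Rightarrow> bool" where
  "nat_ideal I \<longleftrightarrow>
     I \<noteq> {} \<and> I \<subseteq> Pow {1..} \<and>
     (\<forall>A\<in>I. \<forall>B. B \<subseteq> A \<longrightarrow> B \<in> I) \<and>
     (\<forall>A\<in>I. \<forall>B\<in>I. A \<union> B \<in> I) \<and>
     (\<forall>A. A \<subseteq> {1..} \<and> finite A \<longrightarrow> A \<in> I) \<and>
     {1..} \<notin> I"

definition dual_filter :: "nat set set \<Rightarrow> nat set set" where
  "dual_filter I = {{1..} - A | A. A \<in> I}"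

definition ideal_lim :: "nat set set \<Rightarrow> (nat \<Rightarrow> real) \<Rightarrow> real \<Rightarrow> bool" where
  "ideal_lim I x L \<longleftrightarrow> (\<forall>\<epsilon>>0. {n\<in>{1..}. \<bar>x n - L\<bar> \<ge> \<epsilon>} \<in> I)"

text \<open>
  If \<open>I\<close> is an ideal, every member of its dual filter is infinite, so \<open>enumerate F\<close> lists
  \<open>F\<close> in increasing order.
\<close>

definition ideal_star_lim :: "nat set set \<Rightarrow> (nat \<Rightarrow> real) \<Rightarrow> real \<Rightarrow> bool" where
  "ideal_star_lim I x L \<longleftrightarrow> (\<exists>F\<in>dual_filter I. (\<lambda>k. x (enumerate F k)) \<longlonglongrightarrow> L)"

text \<open>
  Used for sequences \<open>d\<close> that are nonnegative on \<open>{1..}\<close>, where \<open>d summable_on A\<close> says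
  that the sum of \<open>d\<close> over \<open>A\<close> is finite.
\<close>

definition summable_ideal :: "(nat \<Rightarrow> real) \<Rightarrow> nat set set" where
  "summable_ideal d = {A. A \<subseteq> {1..} \<and> d summable_on A}"

end

theory Submission
  imports Defs
begin

text \<open>
  Writing \<open>a n = g (x n)\<close>, the hypothesis on \<open>a\<close> is the convergence of \<open>\<Sum> b n * g (x n)\<close> for an
  arbitrary positive sequence \<open>x\<close>. Regular variation gives \<open>g y \<le> K * g (\<epsilon> * y)\<close> for small \<open>y\<close>, so
  each set \<open>{n. c n * x n \<ge> \<epsilon>}\<close> belongs to the summable ideal of \<open>b n * g (1 / c n)\<close>. A summable
  ideal is a P-ideal, so a single member of it almost contains all these sets, and off that member
  \<open>c n * x n\<close> tends to \<open>0\<close>. Conversely, if \<open>A\<close> lies in the summable ideal, the sequence equal to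
  \<open>1 / c n\<close> on \<open>A\<close> and sufficiently small off \<open>A\<close> shows that \<open>A\<close> lies in \<open>I\<close>.
\<close>

lemma nat_idealD:
  assumes "nat_ideal I"
  shows nat_ideal_subset: "A \<in> I \<Longrightarrow> B \<subseteq> A \<Longrightarrow> B \<in> I"
    and nat_ideal_Un: "A \<in> I \<Longrightarrow> B \<in> I \<Longrightarrow> A \<union> B \<in> I"
    and nat_ideal_finite: "A \<subseteq> {1..} \<Longrightarrow> finite A \<Longrightarrow> A \<in> I"
    and nat_ideal_subset_carrier: "A \<in> I \<Longrightarrow> A \<subseteq> {1..}"
    and nat_ideal_proper: "{1..} \<notin> I"
  using assms unfolding nat_ideal_def by (blast, blast, blast, blast, blast)

text \<open>Eliminates \<open>enumerate\<close>. The complement of a member of \<open>I\<close> is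
  infinite, as otherwise finite sets and unions would put \<open>{1..}\<close> into
  \<open>I\<close>. So \<open>enumerate\<close> is a bijection onto it, and convergence depends only
  on the finiteness of the exceptional sets, which a bijection preserves.\<close>

lemma ideal_star_lim_iff:
  assumes I: "nat_ideal I"
  shows "ideal_star_lim I x L \<longleftrightarrow> (\<exists>A\<in>I. \<forall>\<epsilon>>0. finite {n \<in> {1..} - A. \<bar>x n - L\<bar> \<ge> \<epsilon>})"
proof -
  have *: "(\<lambda>k. x (enumerate ({1..} - A) k)) \<longlonglongrightarrow> L \<longleftrightarrow>
      (\<forall>\<epsilon>>0. finite {n \<in> {1..} - A. \<bar>x n - L\<bar> \<ge> \<epsilon>})" if A: "A \<in> I" for A
  proof -
    define F where "F = {1..} - A"
    have inf: "infinite F"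
    proof
      assume "finite F"
      then have "F \<in> I" by (intro nat_ideal_finite[OF I]) (auto simp: F_def)
      then have "A \<union> F \<in> I" by (intro nat_ideal_Un[OF I] A)
      moreover have "A \<union> F = {1..}" using nat_ideal_subset_carrier[OF I A] by (auto simp: F_def)
      ultimately show False using nat_ideal_proper[OF I] by simp
    qed
    have bij: "bij_betw (enumerate F) UNIV F" by (rule bij_enumerate[OF inf])
    have fin: "finite {k. \<bar>x (enumerate F k) - L\<bar> \<ge> \<epsilon>} \<longleftrightarrow> finite {n \<in> F. \<bar>x n - L\<bar> \<ge> \<epsilon>}" for \<epsilon>
      using bij_betw_finite[OF bij_betw_Collect[OF bij, of "\<lambda>n. \<bar>x n - L\<bar> \<ge> \<epsilon>"
        "\<lambda>k. \<bar>x (enumerate F k) - L\<bar> \<ge> \<epsilon>"]] by simp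
    have "(\<lambda>k. x (enumerate F k)) \<longlonglongrightarrow> L \<longleftrightarrow> (\<forall>\<epsilon>>0. finite {k. \<bar>x (enumerate F k) - L\<bar> \<ge> \<epsilon>})"
      unfolding tendsto_iff dist_real_def cofinite_eq_sequentially[symmetric] eventually_cofinite
      by (simp add: not_less)
    then show ?thesis using fin unfolding F_def by simp
  qed
  have "ideal_star_lim I x L \<longleftrightarrow> (\<exists>A\<in>I. (\<lambda>k. x (enumerate ({1..} - A) k)) \<longlonglongrightarrow> L)"
    unfolding ideal_star_lim_def dual_filter_def by blast
  also have "\<dots> \<longleftrightarrow> (\<exists>A\<in>I. \<forall>\<epsilon>>0. finite {n \<in> {1..} - A. \<bar>x n - L\<bar> \<ge> \<epsilon>})"
    by (rule bex_cong[OF refl]) (rule *)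
  finally show ?thesis .
qed

text \<open>Each exceptional set is covered by one fixed member of \<open>I\<close> and a finite
  set.\<close>

lemma ideal_star_lim_imp_ideal_lim:
  assumes I: "nat_ideal I" and lim: "ideal_star_lim I x L"
  shows "ideal_lim I x L"
  unfolding ideal_lim_def
proof (intro allI impI)
  fix \<epsilon> :: real assume "\<epsilon> > 0"
  obtain A where A: "A \<in> I" and "\<forall>\<epsilon>>0. finite {n \<in> {1..} - A. \<bar>x n - L\<bar> \<ge> \<epsilon>}"
    using lim[unfolded ideal_star_lim_iff[OF I]] by (elim bexE)
  then have fin: "finite {n \<in> {1..} - A. \<bar>x n - L\<bar> \<ge> \<epsilon>}"
    using \<open>\<epsilon> > 0\<close> by simp
  have "{n \<in> {1..} - A. \<bar>x n - L\<bar> \<ge> \<epsilon>} \<in> I"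
    using fin by (intro nat_ideal_finite[OF I]) auto
  then have "A \<union> {n \<in> {1..} - A. \<bar>x n - L\<bar> \<ge> \<epsilon>} \<in> I"
    by (intro nat_ideal_Un[OF I] A)
  moreover have "{n \<in> {1..}. \<bar>x n - L\<bar> \<ge> \<epsilon>} \<subseteq> A \<union> {n \<in> {1..} - A. \<bar>x n - L\<bar> \<ge> \<epsilon>}"
    by auto
  ultimately show "{n \<in> {1..}. \<bar>x n - L\<bar> \<ge> \<epsilon>} \<in> I"
    by (rule nat_ideal_subset[OF I])
qed

text \<open>This is the Cauchy criterion for \<open>d\<close> extended by zero off \<open>A\<close>.
  Bounding finite partial sums, rather than an infinite tail sum, is what the proof of the P-ideal
  property uses.\<close>

lemma summable_on_small_tail:
  fixes d :: "nat \<Rightarrow> real"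
  assumes nonneg: "\<And>n. n \<in> A \<Longrightarrow> d n \<ge> 0" and sm: "d summable_on A" and "e > 0"
  shows "\<exists>N. \<forall>F. finite F \<longrightarrow> F \<subseteq> A \<inter> {N..} \<longrightarrow> sum d F \<le> e"
proof -
  define f where "f n = (if n \<in> A then d n else 0)" for n
  have f0: "f n \<ge> 0" for n using nonneg by (simp add: f_def)
  have "f summable_on UNIV"
    using sm by (rule summable_on_cong_neutral[THEN iffD1, rotated -1]) (auto simp: f_def)
  then have "summable f" using f0 by (simp add: summable_on_UNIV_nonneg_real_iff)
  then obtain N where N: "\<And>m n. m \<ge> N \<Longrightarrow> norm (sum f {m..<n}) < e"
    using \<open>e > 0\<close> unfolding summable_Cauchy by blast
  have "sum d F \<le> e" if F: "finite F" "F \<subseteq> A \<inter> {N..}" for F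
  proof -
    obtain n where n: "F \<subseteq> {..<n}" using F(1) finite_nat_iff_bounded by blast
    have "sum d F = sum f F" using F(2) by (intro sum.cong) (auto simp: f_def)
    also have "\<dots> \<le> sum f {N..<n}" using F n f0 by (intro sum_mono2) auto
    also have "\<dots> \<le> e" using N[of N n] by auto
    finally show ?thesis .
  qed
  then show ?thesis by blast
qed

text \<open>Cut each \<open>A k\<close> at a point \<open>N k\<close> beyond which its mass is at
  most \<open>(1/2)^k\<close>. The union \<open>B\<close> of these tails has total mass at most 2,
  and \<open>A k - B\<close> lies below \<open>N k\<close>.\<close>

lemma summable_ideal_P_ideal:
  assumes nonneg: "\<And>n. n \<ge> 1 \<Longrightarrow> d n \<ge> 0"
    and A: "\<And>k::nat. A k \<in> summable_ideal d"
  obtains B where "B \<in> summable_ideal d" "\<And>k. finite (A k - B)"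
proof -
  have A1: "A k \<subseteq> {1..}" and A2: "d summable_on A k" for k
    using A[of k] by (auto simp: summable_ideal_def)
  have dA: "d n \<ge> 0" if "n \<in> A k" for n k using A1[of k] nonneg[of n] that by auto
  have "\<forall>k. \<exists>N. \<forall>F. finite F \<longrightarrow> F \<subseteq> A k \<inter> {N..} \<longrightarrow> sum d F \<le> (1/2)^k"
  proof
    fix k
    show "\<exists>N. \<forall>F. finite F \<longrightarrow> F \<subseteq> A k \<inter> {N..} \<longrightarrow> sum d F \<le> (1/2)^k"
      using dA A2[of k] by (rule summable_on_small_tail) simp_all
  qed
  then obtain N where N: "\<And>k F. finite F \<Longrightarrow> F \<subseteq> A k \<inter> {N k..} \<Longrightarrow> sum d F \<le> (1/2)^k"
    by metis
  define B where "B = (\<Union>k. A k \<inter> {N k..})"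
  have B1: "B \<subseteq> {1..}" using A1 unfolding B_def by blast
  have bound: "sum d F \<le> 2" if F: "finite F" "F \<subseteq> B" for F
  proof -
    \<comment> \<open>The tails may overlap. Choosing one tail \<open>h n\<close> for each point
      splits \<open>F\<close> into disjoint fibres, each inside a single tail.\<close>
    have "\<forall>n\<in>F. \<exists>k. n \<in> A k \<inter> {N k..}" using F(2) unfolding B_def by blast
    then obtain h where h: "\<And>n. n \<in> F \<Longrightarrow> n \<in> A (h n) \<inter> {N (h n)..}" by metis
    have "sum d F = (\<Sum>k\<in>h ` F. \<Sum>n\<in>{n\<in>F. h n = k}. d n)"
      using F(1) by (rule sum.image_gen)
    also have "\<dots> \<le> (\<Sum>k\<in>h ` F. (1/2)^k)"
      using F(1) by (intro sum_mono N) (auto dest: h)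
    also have "\<dots> \<le> (\<Sum>k. (1/2::real)^k)"
      using F(1) by (intro sum_le_suminf) (auto intro: summable_geometric)
    also have "\<dots> = 2" by (subst suminf_geometric) auto
    finally show ?thesis .
  qed
  have "d summable_on B"
  proof (rule nonneg_bdd_above_summable_on)
    show "bdd_above (sum d ` {F. F \<subseteq> B \<and> finite F})"
      using bound by (intro bdd_aboveI[of _ 2]) auto
  qed (use dA in \<open>auto simp: B_def\<close>)
  then have "B \<in> summable_ideal d" using B1 by (simp add: summable_ideal_def)
  moreover have "finite (A k - B)" for k
    by (rule finite_subset[of _ "{..<N k}"]) (auto simp: B_def not_le)
  ultimately show ?thesis by (rule that)
qed

text \<open>For small positive \<open>y\<close>, both quotients lie strictly between
  \<open>M / 2\<close> and \<open>2 * M\<close>; only the upper bound at \<open>y\<close> and the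
  lower bound at \<open>\<epsilon> * y\<close> enter. Their ratio gives the 4, and the scaling gives
  \<open>\<epsilon> powr \<gamma>\<close>.\<close>

lemma regularly_varying_scale_bound:
  fixes g :: "real \<Rightarrow> real"
  assumes lim: "((\<lambda>x. g x / x powr \<gamma>) \<longlongrightarrow> M) (at_right 0)" and "M > 0" "\<epsilon> > 0"
  shows "eventually (\<lambda>y. g y \<le> 4 / \<epsilon> powr \<gamma> * g (\<epsilon> * y)) (at_right 0)"
proof -
  have up: "eventually (\<lambda>y. g y / y powr \<gamma> < 2 * M) (at_right 0)"
    using order_tendstoD(2)[OF lim, of "2 * M"] \<open>M > 0\<close> by simp
  have low: "eventually (\<lambda>y. M / 2 < g y / y powr \<gamma>) (at_right 0)"
    using order_tendstoD(1)[OF lim, of "M / 2"] \<open>M > 0\<close> by simp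
  have "filterlim (\<lambda>y. \<epsilon> * y) (at_right 0) (at_right 0)"
    unfolding filterlim_at using \<open>\<epsilon> > 0\<close>
    by (auto simp: eventually_at_right_less intro!: tendsto_eq_intros eventually_at_rightI[of 0 1])
  then have "eventually (\<lambda>y. M / 2 < g (\<epsilon> * y) / (\<epsilon> * y) powr \<gamma>) (at_right 0)"
    using low by (rule eventually_compose_filterlim[rotated])
  then show ?thesis
    using up eventually_at_right_less
  proof eventually_elim
    case (elim y)
    have p: "y powr \<gamma> > 0" "\<epsilon> powr \<gamma> > 0" using elim \<open>\<epsilon> > 0\<close> by auto
    have "g y \<le> 2 * M * y powr \<gamma>" using elim(2) p by (simp add: field_simps)
    also have "\<dots> = 4 / \<epsilon> powr \<gamma> * (M / 2 * (\<epsilon> * y) powr \<gamma>)"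
      using elim(3) \<open>\<epsilon> > 0\<close> p by (simp add: powr_mult field_simps)
    also have "\<dots> \<le> 4 / \<epsilon> powr \<gamma> * g (\<epsilon> * y)"
    proof (rule mult_left_mono)
      have "(\<epsilon> * y) powr \<gamma> > 0" using elim(3) \<open>\<epsilon> > 0\<close> by simp
      then show "M / 2 * (\<epsilon> * y) powr \<gamma> \<le> g (\<epsilon> * y)"
        using elim(1) by (simp add: field_simps)
    qed (use p in simp)
    finally show ?case .
  qed
qed

lemma tendsto_0_of_tendsto_div_powr:
  fixes g :: "real \<Rightarrow> real"
  assumes lim: "((\<lambda>x. g x / x powr \<gamma>) \<longlongrightarrow> M) (at_right 0)" and "\<gamma> > 0"
  shows "(g \<longlongrightarrow> 0) (at_right 0)"
proof -
  have "((\<lambda>x::real. x powr \<gamma>) \<longlongrightarrow> 0 powr \<gamma>) (at_right 0)"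
    using \<open>\<gamma> > 0\<close>
    by (intro tendsto_powr' tendsto_ident_at tendsto_const)
       (auto intro!: eventually_at_rightI[of 0 1])
  then have "((\<lambda>x. g x / x powr \<gamma> * x powr \<gamma>) \<longlongrightarrow> M * 0 powr \<gamma>) (at_right 0)"
    by (intro tendsto_mult lim)
  moreover have "eventually (\<lambda>x. g x / x powr \<gamma> * x powr \<gamma> = g x) (at_right 0)"
    using eventually_at_right_less by eventually_elim auto
  ultimately show ?thesis by (simp add: tendsto_cong)
qed

theorem theorem2p1:
  fixes I :: "nat set set" and g :: "real \<Rightarrow> real" and \<gamma> M :: real
    and b c :: "nat \<Rightarrow> real"
  assumes "nat_ideal I"
    and "g ` {0<..} \<subseteq> {0<..}"
    and "strict_mono_on {0<..} g"
    and "\<gamma> > 0" and "M > 0"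
    and "((\<lambda>x. g x / x powr \<gamma>) \<longlongrightarrow> M) (at_right 0)"
    and "\<And>n. n \<ge> 1 \<Longrightarrow> b n > 0"
    and "\<And>n. n \<ge> 1 \<Longrightarrow> c n > 0"
    and "filterlim c at_top sequentially"
  shows
    "((\<forall>a :: nat \<Rightarrow> real. (\<forall>n\<ge>1. a n \<in> g ` {0<..}) \<longrightarrow> (\<lambda>n. b n * a n) summable_on {1..} \<longrightarrow>
         ideal_star_lim I (\<lambda>n. c n * inv_into {0<..} g (a n)) 0)
      \<longleftrightarrow>
      (\<forall>a :: nat \<Rightarrow> real. (\<forall>n\<ge>1. a n \<in> g ` {0<..}) \<longrightarrow> (\<lambda>n. b n * a n) summable_on {1..} \<longrightarrow>
         ideal_lim I (\<lambda>n. c n * inv_into {0<..} g (a n)) 0))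
     \<and>
     ((\<forall>a :: nat \<Rightarrow> real. (\<forall>n\<ge>1. a n \<in> g ` {0<..}) \<longrightarrow> (\<lambda>n. b n * a n) summable_on {1..} \<longrightarrow>
         ideal_lim I (\<lambda>n. c n * inv_into {0<..} g (a n)) 0)
      \<longleftrightarrow>
      summable_ideal (\<lambda>n. b n * g (1 / c n)) \<subseteq> I)"
proof -
  note I = assms(1) and gpos = assms(2) and mono = assms(3) and lim = assms(6)
  note b = assms(7) and c = assms(8)
  have g0: "g x > 0" if "x > 0" for x using gpos that by auto
  have inv: "inv_into {0<..} g (g x) = x" if "x > 0" for x
    using that strict_mono_on_imp_inj_on[OF mono] by simp
  have gmono: "g x \<le> g y" if "0 < x" "x \<le> y" for x y
    using mono that by (cases "x = y") (auto simp: strict_mono_on_def less_imp_le)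
  define d where "d n = b n * g (1 / c n)" for n
  have d0: "d n \<ge> 0" if "n \<ge> 1" for n
    using b[OF that] g0[of "1 / c n"] c[OF that] by (simp add: d_def)
  let ?H = "\<lambda>a. (\<forall>n\<ge>1. a n \<in> g ` {0<..}) \<and> (\<lambda>n. b n * a n) summable_on {1..}"
  let ?x = "\<lambda>a n. c n * inv_into {0<..} g (a n)"
  \<comment> \<open>The equivalences come from the cycle (1) to (2) to (3) to (1).\<close>
  have 12: "ideal_lim I (?x a) 0" if "ideal_star_lim I (?x a) 0" for a
    using ideal_star_lim_imp_ideal_lim[OF I that] .
  have 23: "summable_ideal d \<subseteq> I" if two: "\<And>a. ?H a \<Longrightarrow> ideal_lim I (?x a) 0"
  proof
    fix A assume "A \<in> summable_ideal d"
    then have A: "A \<subseteq> {1..}" "d summable_on A" by (auto simp: summable_ideal_def)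
    \<comment> \<open>Since \<open>g\<close> tends to 0 at 0, the factor \<open>b n\<close> can be
      compensated for each \<open>n\<close> separately, however fast \<open>b\<close> grows.\<close>
    have "\<exists>y>0. b n * g y \<le> (1/2)^n" if n: "n \<ge> 1" for n
    proof -
      have "eventually (\<lambda>y. g y < (1/2)^n / b n) (at_right 0)"
        using order_tendstoD(2)[OF tendsto_0_of_tendsto_div_powr[OF lim assms(4)]] b[OF n] by simp
      then have "eventually (\<lambda>y. 0 < y \<and> g y < (1/2)^n / b n) (at_right 0)"
        using eventually_at_right_less by eventually_elim auto
      then obtain y where "0 < y" "g y < (1/2)^n / b n"
        using eventually_happens[of _ "at_right (0::real)"] by auto
      then show ?thesis using b[OF n]
        by (intro exI[of _ y]) (auto simp: field_simps)
    qed
    then obtain y where y: "\<And>n. n \<ge> 1 \<Longrightarrow> y n > 0" "\<And>n. n \<ge> 1 \<Longrightarrow> b n * g (y n) \<le> (1/2)^n"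
      by metis
    \<comment> \<open>On \<open>A\<close> the series has the terms \<open>d n\<close>, summable by
      assumption; off \<open>A\<close> a geometric series dominates it.\<close>
    define x where "x n = (if n \<in> A then 1 / c n else y n)" for n
    have x0: "x n > 0" if "n \<ge> 1" for n using c[OF that] y(1)[OF that] by (simp add: x_def)
    have "(\<lambda>n. b n * g (x n)) summable_on A \<union> ({1..} - A)"
    proof (rule summable_on_Un_disjoint)
      show "(\<lambda>n. b n * g (x n)) summable_on A"
        using A(2) by (rule summable_on_cong[THEN iffD1, rotated]) (simp add: x_def d_def)
      have "(\<lambda>n. (1/2::real)^n) summable_on UNIV"
        by (simp add: summable_on_UNIV_nonneg_real_iff summable_geometric)
      then have "(\<lambda>n. (1/2::real)^n) summable_on {1..} - A"
        by (rule summable_on_subset_banach) auto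
      then show "(\<lambda>n. b n * g (x n)) summable_on {1..} - A"
        by (rule summable_on_comparison_test)
           (use b y g0 in \<open>auto simp: x_def intro!: mult_nonneg_nonneg less_imp_le\<close>)
    qed auto
    also have "A \<union> ({1..} - A) = {1..}" using A(1) by auto
    finally have "ideal_lim I (?x (\<lambda>n. g (x n))) 0"
      using x0 by (intro two) auto
    \<comment> \<open>On \<open>A\<close> the product \<open>c n * x n\<close> equals 1 exactly, so
      the threshold 1 captures all of \<open>A\<close>.\<close>
    then have "{n\<in>{1..}. \<bar>?x (\<lambda>n. g (x n)) n - 0\<bar> \<ge> 1} \<in> I"
      unfolding ideal_lim_def by (meson zero_less_one)
    moreover have "A \<subseteq> {n\<in>{1..}. \<bar>?x (\<lambda>n. g (x n)) n - 0\<bar> \<ge> 1}"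
    proof
      fix n assume n: "n \<in> A"
      then have n1: "n \<ge> 1" using A(1) by auto
      show "n \<in> {n\<in>{1..}. \<bar>?x (\<lambda>n. g (x n)) n - 0\<bar> \<ge> 1}"
        using n n1 c[OF n1] inv[OF x0[OF n1]] by (simp add: x_def)
    qed
    ultimately show "A \<in> I" by (rule nat_ideal_subset[OF I])
  qed
  have 31: "ideal_star_lim I (?x a) 0" if three: "summable_ideal d \<subseteq> I" and a: "?H a" for a
  proof -
    define x where "x n = inv_into {0<..} g (a n)" for n
    have x0: "x n > 0" and gx: "g (x n) = a n" if "n \<ge> 1" for n
      using a that inv_into_into[of "a n" g "{0<..}"] f_inv_into_f[of "a n" g "{0<..}"]
      by (auto simp: x_def)
    have inv_c: "filterlim (\<lambda>n. 1 / c n) (at_right 0) sequentially"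
      using filterlim_compose[OF filterlim_inverse_at_right_top assms(9)]
      by (simp add: inverse_eq_divide)
    \<comment> \<open>On this set \<open>\<epsilon> / c n \<le> x n\<close>, so monotonicity gives
      \<open>g (\<epsilon> / c n) \<le> a n\<close>. As \<open>1 / c n\<close> tends to 0 from the
      right, the scaling bound at \<open>y = 1 / c n\<close> yields
      \<open>d n \<le> K * (b n * a n)\<close> from some \<open>N\<close> on; the indices below
      \<open>N\<close> are finitely many.\<close>
    have mem: "{n\<in>{1..}. c n * x n \<ge> \<epsilon>} \<in> summable_ideal d" if e: "\<epsilon> > 0" for \<epsilon>
    proof -
      let ?A = "{n\<in>{1..}. c n * x n \<ge> \<epsilon>}"
      define K where "K = 4 / \<epsilon> powr \<gamma>"
      have "eventually (\<lambda>n. g (1 / c n) \<le> K * g (\<epsilon> * (1 / c n))) sequentially"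
        unfolding K_def
        using inv_c regularly_varying_scale_bound[OF lim assms(5) e]
        by (rule eventually_compose_filterlim[rotated])
      then obtain N where N: "\<And>n. n \<ge> N \<Longrightarrow> g (1 / c n) \<le> K * g (\<epsilon> * (1 / c n))"
        unfolding eventually_sequentially by blast
      have "(\<lambda>n. K * (b n * a n)) summable_on {1..}"
        using a by (intro summable_on_cmult_right) auto
      then have "(\<lambda>n. K * (b n * a n)) summable_on ?A \<inter> {N..}"
        by (rule summable_on_subset_banach) auto
      then have "d summable_on ?A \<inter> {N..}"
      proof (rule summable_on_comparison_test)
        fix n assume n: "n \<in> ?A \<inter> {N..}"
        then have n1: "n \<ge> 1" and nN: "n \<ge> N" by auto
        have "\<epsilon> * (1 / c n) \<le> x n" using n c[OF n1] by (simp add: field_simps)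
        then have "g (\<epsilon> * (1 / c n)) \<le> a n"
          using gmono[of "\<epsilon> * (1 / c n)" "x n"] gx[OF n1] c[OF n1] e by simp
        then have "K * g (\<epsilon> * (1 / c n)) \<le> K * a n"
          using e by (intro mult_left_mono) (auto simp: K_def)
        then have "g (1 / c n) \<le> K * a n" using N[OF nN] by linarith
        then have "b n * g (1 / c n) \<le> b n * (K * a n)"
          using b[OF n1] by (intro mult_left_mono) auto
        then show "d n \<le> K * (b n * a n)" by (simp add: d_def mult_ac)
        show "0 \<le> d n" by (rule d0[OF n1])
      qed
      moreover have "finite (?A \<inter> {..<N})" by simp
      then have "d summable_on ?A \<inter> {..<N}" by (rule summable_on_finite)
      ultimately have "d summable_on (?A \<inter> {N..}) \<union> (?A \<inter> {..<N})"
        by (rule summable_on_Un_disjoint) auto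
      also have "(?A \<inter> {N..}) \<union> (?A \<inter> {..<N}) = ?A" by auto
      finally show ?thesis by (auto simp: summable_ideal_def)
    qed
    \<comment> \<open>The P-ideal property handles countably many sets, so the thresholds are
      restricted to the reciprocals of positive integers, which get below every positive
      \<open>\<epsilon>\<close>.\<close>
    let ?A = "\<lambda>k. {n\<in>{1..}. c n * x n \<ge> inverse (real (Suc k))}"
    obtain B where B: "B \<in> summable_ideal d" and fin: "\<And>k. finite (?A k - B)"
      by (rule summable_ideal_P_ideal[where d = d and A = ?A]) (use d0 mem in auto)
    have "finite {n \<in> {1..} - B. \<bar>?x a n - 0\<bar> \<ge> \<epsilon>}" if e: "\<epsilon> > 0" for \<epsilon>
    proof -
      obtain k where k: "inverse (real (Suc k)) < \<epsilon>" using reals_Archimedean[OF e] by blast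
      have "{n \<in> {1..} - B. \<bar>?x a n - 0\<bar> \<ge> \<epsilon>} \<subseteq> ?A k - B"
      proof
        fix n assume n: "n \<in> {n \<in> {1..} - B. \<bar>?x a n - 0\<bar> \<ge> \<epsilon>}"
        then have n1: "n \<ge> 1" by auto
        \<comment> \<open>Positivity removes the absolute value, which the sets \<open>?A k\<close>
          do not have.\<close>
        have "c n * x n > 0" using c[OF n1] x0[OF n1] by simp
        then show "n \<in> ?A k - B" using n k by (simp add: x_def)
      qed
      then show ?thesis using fin[of k] finite_subset by blast
    qed
    moreover have "B \<in> I" using three B by (rule subsetD)
    ultimately show ?thesis unfolding ideal_star_lim_iff[OF I] by (intro bexI[of _ B] allI impI)
  qed
  have d_eq: "(\<lambda>n. b n * g (1 / c n)) = d" by (simp add: d_def fun_eq_iff)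
  let ?two = "\<forall>a. ?H a \<longrightarrow> ideal_lim I (?x a) 0"
  let ?one = "\<forall>a. ?H a \<longrightarrow> ideal_star_lim I (?x a) 0"
  have "?one \<longrightarrow> ?two" using 12 by blast
  moreover have "?two \<longrightarrow> summable_ideal d \<subseteq> I" using 23 by blast
  moreover have "summable_ideal d \<subseteq> I \<longrightarrow> ?one" using 31 by blast
  ultimately have "(?one \<longleftrightarrow> ?two) \<and> (?two \<longleftrightarrow> summable_ideal d \<subseteq> I)" by argo
  \<comment> \<open>The theorem states the two hypotheses on \<open>a\<close> as nested
    implications, whereas \<open>?H\<close> is their conjunction.\<close>
  then show ?thesis unfolding d_eq by (simp only: imp_conjL)
qed

end
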